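(* Let $C_1$ and $C_2$ be closed planar curves in $\mathbb{R}^3$ with diameters $d_1$ and $d_2$, lying in parallel planes which are at distance $h$ apart. If $C_1\cup C_2$ is the boundary of a compact connected minimal surface $M$, then $h\le\max\{d_1,d_2\}$.
   Context: No assumption is made on the topology of $M$. *)

theory Defs
  imports "HOL-Analysis.Analysis"
begin

definition closed_curve :: "'b::topological_space set \<Rightarrow> bool" where
  "closed_curve C \<longleftrightarrow> (\<exists>g. path g \<and> pathfinish g = pathstart g \<and> C = path_image g)"

definition half_plane :: "(real^2) set" where
  "half_plane = {x. 0 \<le> x $ 2}"

definition surface_with_boundary :: "'a topology \<Rightarrow> bool" where
  "surface_with_boundary S \<longleftrightarrow>
     Hausdorff_space S \<and> second_countable S \<and>
     (\<forall>p \<in> topspace S. \<exists>W V. openin S W \<and> p \<in> W \<and>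
        openin (top_of_set half_plane) V \<and>
        subtopology S W homeomorphic_space top_of_set V)"

definition surface_interior :: "'a topology \<Rightarrow> 'a set" where
  "surface_interior S =
     {p. \<exists>W U. openin S W \<and> p \<in> W \<and> open (U :: (real^2) set) \<and>
        subtopology S W homeomorphic_space top_of_set U}"

definition surface_boundary :: "'a topology \<Rightarrow> 'a set" where
  "surface_boundary S = topspace S - surface_interior S"

definition partial_deriv :: "'n::finite \<Rightarrow> (real^'n \<Rightarrow> 'b::real_normed_vector) \<Rightarrow> real^'n \<Rightarrow> 'b" where
  "partial_deriv i X u = frechet_derivative X (at u) (axis i 1)"

text \<open>\<open>Ck_on k X U\<close>: the map \<open>X\<close> is of class \<open>C\<^sup>k\<close> on the open set \<open>U\<close>.\<close>

primrec Ck_on :: "nat \<Rightarrow> (real^'n::finite \<Rightarrow> 'b::real_normed_vector) \<Rightarrow> (real^'n) set \<Rightarrow> bool" where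
  "Ck_on 0 X U \<longleftrightarrow> continuous_on U X"
| "Ck_on (Suc k) X U \<longleftrightarrow>
     X differentiable_on U \<and> (\<forall>i. Ck_on k (partial_deriv i X) U)"

definition unit_normal :: "(real^2 \<Rightarrow> real^3) \<Rightarrow> real^2 \<Rightarrow> real^3" where
  "unit_normal X u = sgn (cross3 (partial_deriv 1 X u) (partial_deriv 2 X u))"

definition first_fundamental_form :: "(real^2 \<Rightarrow> real^3) \<Rightarrow> 2 \<Rightarrow> 2 \<Rightarrow> real^2 \<Rightarrow> real" where
  "first_fundamental_form X i j u = partial_deriv i X u \<bullet> partial_deriv j X u"

definition second_fundamental_form :: "(real^2 \<Rightarrow> real^3) \<Rightarrow> 2 \<Rightarrow> 2 \<Rightarrow> real^2 \<Rightarrow> real" where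
  "second_fundamental_form X i j u = partial_deriv i (partial_deriv j X) u \<bullet> unit_normal X u"

definition mean_curvature :: "(real^2 \<Rightarrow> real^3) \<Rightarrow> real^2 \<Rightarrow> real" where
  "mean_curvature X u =
     (let g = (\<lambda>i j. first_fundamental_form X i j u);
          b = (\<lambda>i j. second_fundamental_form X i j u)
      in (b 1 1 * g 2 2 - 2 * b 1 2 * g 1 2 + b 2 2 * g 1 1)
           / (2 * (g 1 1 * g 2 2 - (g 1 2)\<^sup>2)))"

text \<open>
  A minimal surface in space is given by a topological surface \<open>S\<close> and a map \<open>F\<close>, continuous up to
  the boundary, which is a minimal immersion of class \<open>C\<^sup>2\<close> on the interior.  No differentiable
  structure on \<open>S\<close> has to be specified: charts in which \<open>F\<close> is a \<open>C\<^sup>2\<close> immersion are automatically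
  \<open>C\<^sup>2\<close> compatible, so \<open>F\<close> determines the structure.  Conversely any \<open>C\<^sup>2\<close> immersion of an abstract
  surface is of this form.  The embedded surface \<open>M\<close> is the case \<open>S = top_of_set M\<close>, \<open>F = id\<close>.
\<close>

definition minimal_surface :: "'a topology \<Rightarrow> ('a \<Rightarrow> real^3) \<Rightarrow> bool" where
  "minimal_surface S F \<longleftrightarrow>
     surface_with_boundary S \<and> continuous_map S euclidean F \<and>
     (\<forall>p \<in> surface_interior S. \<exists>U W \<phi>.
        open U \<and> openin S W \<and> p \<in> W \<and>
        homeomorphic_map (top_of_set U) (subtopology S W) \<phi> \<and>
        Ck_on 2 (F \<circ> \<phi>) U \<and>
        (\<forall>u \<in> U. inj (frechet_derivative (F \<circ> \<phi>) (at u)) \<and>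
                  mean_curvature (F \<circ> \<phi>) u = 0))"

end

theory Submission
  imports Defs
begin

text \<open>
  Suppose \<open>h > d = max d\<^sub>1 d\<^sub>2\<close>.  Each curve lies in a square of side \<open>d\<close>, hence in a disc of radius
  \<open>d/\<surd>2\<close>.  From the midpoint \<open>a\<close> of the two centres, which is at distance \<open>h/2\<close> from both
  planes, such a disc is seen within a circular cone of slope less than \<open>\<surd>2\<close>, even if the centres
  are not aligned vertically, provided that the axis of the cone is chosen well.  So the boundary
  lies inside the two opposite nappes of a cone \<open>r\<^sup>2 < 4kz\<^sup>2\<close> with \<open>k < 1/2\<close>.

  The surfaces of revolution \<open>r = \<mu> + kz\<^sup>2/\<mu>\<close>, \<open>\<mu> > 0\<close>, are tangent to this cone from outside and
  sweep out its exterior.  For \<open>k < 1/2\<close> they act as barriers, in the way catenoids do: a minimal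
  surface cannot touch one of them from the axis side at an interior point.  Considering the largest
  \<open>\<mu>\<close> for which the minimal surface meets the barrier shows that it remains in the cone.  As it is
  connected, it passes through the vertex, but a solid cone with its two nappes contains no
  tangent plane at the vertex.
\<close>

section \<open>Second derivatives along lines\<close>

lemma has_derivative_partial_deriv:
  fixes X :: "real^2 \<Rightarrow> 'b::real_normed_vector"
  assumes "open U" "X differentiable_on U" "u \<in> U"
  shows "(X has_derivative (\<lambda>v. v$1 *\<^sub>R partial_deriv 1 X u + v$2 *\<^sub>R partial_deriv 2 X u)) (at u)"
proof -
  have "X differentiable (at u)"
    using assms by (simp add: differentiable_on_eq_differentiable_at)
  then have D: "(X has_derivative frechet_derivative X (at u)) (at u)"
    by (simp add: frechet_derivative_works)
  then interpret linear "frechet_derivative X (at u)"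
    by (rule has_derivative_linear)
  have "v = v$1 *\<^sub>R axis 1 1 + v$2 *\<^sub>R axis 2 1" for v :: "real^2"
    by (simp add: vec_eq_iff axis_def forall_2)
  then have "frechet_derivative X (at u) v =
      v$1 *\<^sub>R partial_deriv 1 X u + v$2 *\<^sub>R partial_deriv 2 X u" for v
    unfolding partial_deriv_def by (metis add scale)
  then have "frechet_derivative X (at u) =
      (\<lambda>v. v$1 *\<^sub>R partial_deriv 1 X u + v$2 *\<^sub>R partial_deriv 2 X u)" ..
  with D show ?thesis by simp
qed

lemma has_vector_derivative_along_line:
  fixes X :: "real^2 \<Rightarrow> 'b::real_normed_vector"
  assumes "open U" "X differentiable_on U" "u + t *\<^sub>R v \<in> U"
  shows "((\<lambda>t. X (u + t *\<^sub>R v)) has_vector_derivative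
      (v$1 *\<^sub>R partial_deriv 1 X (u + t *\<^sub>R v) + v$2 *\<^sub>R partial_deriv 2 X (u + t *\<^sub>R v))) (at t)"
proof -
  have "((\<lambda>t. u + t *\<^sub>R v) has_derivative (\<lambda>t. t *\<^sub>R v)) (at t)"
    by (auto intro!: derivative_eq_intros)
  from has_derivative_compose[OF this has_derivative_partial_deriv[OF assms]]
  show ?thesis
    by (simp add: has_vector_derivative_def scaleR_add_right)
qed

text \<open>The mean value theorem is applied to \<open>f x s - f x 0\<close> as a function of
  \<open>x\<close>, then to \<open>fx x\<close> in the second variable. The second difference is
  unchanged when the variables of \<open>f\<close> are exchanged, so it can be computed through
  either mixed derivative.\<close>

lemma second_difference_mean_value:
  fixes f :: "real \<Rightarrow> real \<Rightarrow> real"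
  assumes "0 < s"
    and fx: "\<And>x y. \<lbrakk>0 \<le> x; x \<le> s; 0 \<le> y; y \<le> s\<rbrakk> \<Longrightarrow> ((\<lambda>x. f x y) has_real_derivative fx x y) (at x)"
    and fxy: "\<And>x y. \<lbrakk>0 \<le> x; x \<le> s; 0 \<le> y; y \<le> s\<rbrakk> \<Longrightarrow> ((\<lambda>y. fx x y) has_real_derivative fxy x y) (at y)"
  shows "\<exists>x y. 0 < x \<and> x < s \<and> 0 < y \<and> y < s \<and> f s s - f s 0 - f 0 s + f 0 0 = s\<^sup>2 * fxy x y"
proof -
  have "\<exists>x>0. x < s \<and> (f s s - f s 0) - (f 0 s - f 0 0) = (s - 0) * (fx x s - fx x 0)"
    using assms by (intro MVT2) (auto intro!: DERIV_diff)
  then obtain x where x: "0 < x" "x < s" "(f s s - f s 0) - (f 0 s - f 0 0) = s * (fx x s - fx x 0)"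
    by auto
  have "\<exists>y>0. y < s \<and> fx x s - fx x 0 = (s - 0) * fxy x y"
    using assms x by (intro MVT2) auto
  then obtain y where "0 < y" "y < s" "fx x s - fx x 0 = s * fxy x y"
    by auto
  with x show ?thesis
    by (intro exI[of _ x] exI[of _ y]) (simp add: power2_eq_square)
qed

text \<open>Testing against the difference \<open>c\<close> of the two mixed derivatives reduces the
  claim to real functions. If \<open>c\<close> were nonzero, continuity would keep \<open>p\<close>
  above and \<open>q\<close> below a value \<open>m\<close> on a small square, although a value of
  \<open>p\<close> and a value of \<open>q\<close> there both give the same second
  difference.\<close>

lemma partial_deriv_commute:
  fixes X :: "real^2 \<Rightarrow> 'b::real_inner"
  assumes "open U" and C2: "Ck_on 2 X U" and u: "u \<in> U"
  shows "partial_deriv 1 (partial_deriv 2 X) u = partial_deriv 2 (partial_deriv 1 X) u"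
proof (rule ccontr)
  have diff: "X differentiable_on U" "partial_deriv i X differentiable_on U"
    and cont: "continuous_on U (partial_deriv j (partial_deriv i X))" for i j
    using C2 by (simp_all add: numeral_2_eq_2)
  define c where "c = partial_deriv 1 (partial_deriv 2 X) u - partial_deriv 2 (partial_deriv 1 X) u"
  define p where "p = (\<lambda>v. c \<bullet> partial_deriv 1 (partial_deriv 2 X) v)"
  define q where "q = (\<lambda>v. c \<bullet> partial_deriv 2 (partial_deriv 1 X) v)"
  assume "partial_deriv 1 (partial_deriv 2 X) u \<noteq> partial_deriv 2 (partial_deriv 1 X) u"
  then have "c \<bullet> c > 0"
    by (simp add: c_def)
  then have "q u < p u"
    by (simp add: p_def q_def c_def inner_diff_right)
  define m where "m = (p u + q u) / 2"
  have "q u < m" "m < p u"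
    using \<open>q u < p u\<close> by (simp_all add: m_def)
  have pq: "isCont p u" "isCont q u"
    using \<open>open U\<close> u unfolding p_def q_def
    by (auto intro!: continuous_intros cont[THEN continuous_on_interior] simp: interior_open)
  from pq \<open>m < p u\<close> \<open>q u < m\<close> have "\<forall>\<^sub>F v in nhds u. v \<in> U \<and> m < p v \<and> q v < m"
    using \<open>open U\<close> u by (auto intro!: eventually_conj eventually_nhds_in_open
      order_tendstoD simp: isCont_def tendsto_at_iff_tendsto_nhds)
  then obtain \<delta> where "\<delta> > 0" and \<delta>: "\<And>v. dist v u < \<delta> \<Longrightarrow> v \<in> U \<and> m < p v \<and> q v < m"
    unfolding eventually_nhds_metric by blast
  \<comment> \<open>A point of the square is reached by two axis steps of length at most
    \<open>s\<close>, so it stays within \<open>2 * s < \<delta>\<close> of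
    \<open>u\<close>.\<close>
  define s where "s = \<delta> / 3"
  define r where "r = (\<lambda>x y. u + x *\<^sub>R axis 1 1 + y *\<^sub>R axis 2 1 :: real^2)"
  have r_mem: "r x y \<in> U \<and> m < p (r x y) \<and> q (r x y) < m"
    if "0 \<le> x" "x \<le> s" "0 \<le> y" "y \<le> s" for x y
  proof (rule \<delta>)
    have "dist (r x y) u \<le> norm (x *\<^sub>R axis 1 1 :: real^2) + norm (y *\<^sub>R axis 2 1 :: real^2)"
      by (simp add: r_def dist_norm del: norm_scaleR) (rule norm_triangle_ineq)
    also have "\<dots> < \<delta>"
      using that \<open>\<delta> > 0\<close> by (simp add: s_def)
    finally show "dist (r x y) u < \<delta>" .
  qed
  have dx: "((\<lambda>x. c \<bullet> Y (r x y)) has_real_derivative c \<bullet> partial_deriv 1 Y (r x y)) (at x)"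
    and dy: "((\<lambda>y. c \<bullet> Y (r x y)) has_real_derivative c \<bullet> partial_deriv 2 Y (r x y)) (at y)"
    if "Y differentiable_on U" "0 \<le> x" "x \<le> s" "0 \<le> y" "y \<le> s" for Y x y
  proof -
    have r: "r x y = (u + y *\<^sub>R axis 2 1) + x *\<^sub>R axis 1 1" "r x y = (u + x *\<^sub>R axis 1 1) + y *\<^sub>R axis 2 1" for x y
      by (simp_all add: r_def)
    show "((\<lambda>x. c \<bullet> Y (r x y)) has_real_derivative c \<bullet> partial_deriv 1 Y (r x y)) (at x)"
      using has_vector_derivative_along_line[OF \<open>open U\<close> that(1), of "u + y *\<^sub>R axis 2 1" x "axis 1 1"] r_mem[OF that(2-)]
      by (auto simp: r(1) axis_def has_real_derivative_iff_has_vector_derivative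
        intro!: bounded_linear.has_vector_derivative[OF bounded_linear_inner_right])
    show "((\<lambda>y. c \<bullet> Y (r x y)) has_real_derivative c \<bullet> partial_deriv 2 Y (r x y)) (at y)"
      using has_vector_derivative_along_line[OF \<open>open U\<close> that(1), of "u + x *\<^sub>R axis 1 1" y "axis 2 1"] r_mem[OF that(2-)]
      by (auto simp: r(2) axis_def has_real_derivative_iff_has_vector_derivative
        intro!: bounded_linear.has_vector_derivative[OF bounded_linear_inner_right])
  qed
  have "s > 0" using \<open>\<delta> > 0\<close> by (simp add: s_def)
  define f where "f = (\<lambda>x y. c \<bullet> X (r x y))"
  obtain x y where xy: "0 < x" "x < s" "0 < y" "y < s"
    and "f s s - f s 0 - f 0 s + f 0 0 = s\<^sup>2 * q (r x y)"
    using second_difference_mean_value[of s f "\<lambda>x y. c \<bullet> partial_deriv 1 X (r x y)" "\<lambda>x y. q (r x y)"]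
      \<open>s > 0\<close> dx[OF diff(1)] dy[OF diff(2)] unfolding f_def q_def by blast
  moreover obtain x' y' where xy': "0 < x'" "x' < s" "0 < y'" "y' < s"
    and "f s s - f 0 s - f s 0 + f 0 0 = s\<^sup>2 * p (r y' x')"
    using second_difference_mean_value[of s "\<lambda>x y. f y x" "\<lambda>x y. c \<bullet> partial_deriv 2 X (r y x)" "\<lambda>x y. p (r y x)"]
      \<open>s > 0\<close> dy[OF diff(1)] dx[OF diff(2)] unfolding f_def p_def by blast
  ultimately have "s\<^sup>2 * p (r y' x') = s\<^sup>2 * q (r x y)"
    by linarith
  then have "p (r y' x') = q (r x y)"
    using \<open>s > 0\<close> by simp
  with r_mem[of x y] r_mem[of y' x'] xy xy' show False by auto
qed

text \<open>If \<open>D\<close> were positive, \<open>g'\<close> would be positive just to the right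
  of \<open>0\<close>, and the mean value theorem would give a value of \<open>g\<close> above
  \<open>g 0\<close>.\<close>

lemma second_derivative_nonpos_at_max:
  fixes g g' :: "real \<Rightarrow> real"
  assumes "\<delta> > 0" and g: "\<And>t. \<bar>t\<bar> < \<delta> \<Longrightarrow> (g has_real_derivative g' t) (at t)"
    and g': "(g' has_real_derivative D) (at 0)"
    and max: "\<And>t. \<bar>t\<bar> < \<delta> \<Longrightarrow> g t \<le> g 0"
  shows "g' 0 = 0" "D \<le> 0"
proof -
  show 0: "g' 0 = 0"
    using DERIV_local_max[OF g, of 0 \<delta>] assms by auto
  show "D \<le> 0"
  proof (rule ccontr)
    assume "\<not> D \<le> 0"
    then obtain d where d: "d > 0" "\<And>t. 0 < t \<Longrightarrow> t < d \<Longrightarrow> g' 0 < g' t"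
      using DERIV_pos_inc_right[OF g'] by auto
    define t where "t = min d \<delta> / 2"
    have t: "0 < t" "t < d" "t < \<delta>" using d \<open>\<delta> > 0\<close> by (auto simp: t_def)
    have "\<exists>z>0. z < t \<and> g t - g 0 = (t - 0) * g' z"
      using t g by (intro MVT2) auto
    then obtain z where "0 < z" "z < t" "g t - g 0 = t * g' z" by auto
    moreover have "g' z > 0" using d(2)[of z] 0 calculation t by auto
    ultimately have "t * g' z > 0" using t by simp
    with \<open>g t - g 0 = t * g' z\<close> max[of t] t show False by linarith
  qed
qed

text \<open>Surfaces of revolution about the line through \<open>a\<close> with direction
  \<open>e\<close> are level sets of \<open>y \<bullet> y - P (e \<bullet> y)\<close>, and
  \<open>w\<close> is the gradient of this function. The conclusions are the first and second order
  conditions for its restriction to the curve \<open>X (u + t *\<^sub>R v)\<close>, whose velocity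
  at \<open>t = 0\<close> is \<open>Y\<close>.\<close>

lemma derivatives_at_max:
  fixes X :: "real^2 \<Rightarrow> 'b::real_inner" and u v :: "real^2"
  assumes "open U" and C2: "Ck_on 2 X U" and u: "u \<in> U"
    and P: "\<And>s. (P has_real_derivative P' s) (at s)" "\<And>s. (P' has_real_derivative P'' s) (at s)"
    and max: "\<And>v. v \<in> U \<Longrightarrow> (X v - a) \<bullet> (X v - a) - P (e \<bullet> (X v - a)) \<le> (X u - a) \<bullet> (X u - a) - P (e \<bullet> (X u - a))"
  defines "y \<equiv> X u - a"
  defines "w \<equiv> 2 *\<^sub>R y - P' (e \<bullet> y) *\<^sub>R e"
  defines "Y \<equiv> v$1 *\<^sub>R partial_deriv 1 X u + v$2 *\<^sub>R partial_deriv 2 X u"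
  shows "w \<bullet> Y = 0"
    and "2 * (Y \<bullet> Y) - P'' (e \<bullet> y) * (e \<bullet> Y)\<^sup>2 + w \<bullet> ((v$1)\<^sup>2 *\<^sub>R partial_deriv 1 (partial_deriv 1 X) u
      + (2 * v$1 * v$2) *\<^sub>R partial_deriv 1 (partial_deriv 2 X) u + (v$2)\<^sup>2 *\<^sub>R partial_deriv 2 (partial_deriv 2 X) u) \<le> 0"
proof -
  have diff: "X differentiable_on U" "partial_deriv i X differentiable_on U" for i
    using C2 by (simp_all add: numeral_2_eq_2)
  define Z where "Z = (v$1)\<^sup>2 *\<^sub>R partial_deriv 1 (partial_deriv 1 X) u
      + (2 * v$1 * v$2) *\<^sub>R partial_deriv 1 (partial_deriv 2 X) u + (v$2)\<^sup>2 *\<^sub>R partial_deriv 2 (partial_deriv 2 X) u"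
  define \<gamma> where "\<gamma> = (\<lambda>t. X (u + t *\<^sub>R v) - a)"
  define \<gamma>' where "\<gamma>' = (\<lambda>t. v$1 *\<^sub>R partial_deriv 1 X (u + t *\<^sub>R v) + v$2 *\<^sub>R partial_deriv 2 X (u + t *\<^sub>R v))"
  have at0: "\<gamma> 0 = y" "\<gamma>' 0 = Y"
    by (simp_all add: \<gamma>_def \<gamma>'_def y_def Y_def)
  have "((\<lambda>t. u + t *\<^sub>R v) \<longlongrightarrow> u + 0 *\<^sub>R v) (at 0)"
    by (intro tendsto_intros)
  then have "\<forall>\<^sub>F t in at 0. u + t *\<^sub>R v \<in> U"
    using \<open>open U\<close> u by (auto dest: topological_tendstoD)
  then obtain \<delta> where "\<delta> > 0" and \<delta>': "\<And>t. t \<noteq> 0 \<Longrightarrow> \<bar>t\<bar> < \<delta> \<Longrightarrow> u + t *\<^sub>R v \<in> U"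
    unfolding eventually_at by auto
  have \<delta>: "u + t *\<^sub>R v \<in> U" if "\<bar>t\<bar> < \<delta>" for t
    using \<delta>'[of t] that u by (cases "t = 0") auto
  have d\<gamma>: "(\<gamma> has_vector_derivative \<gamma>' t) (at t)" if "\<bar>t\<bar> < \<delta>" for t
    unfolding \<gamma>_def \<gamma>'_def has_vector_derivative_diff_const
    by (intro has_vector_derivative_along_line[OF \<open>open U\<close> diff(1) \<delta>[OF that]])
  have "(\<gamma>' has_vector_derivative
      v$1 *\<^sub>R (v$1 *\<^sub>R partial_deriv 1 (partial_deriv 1 X) u + v$2 *\<^sub>R partial_deriv 2 (partial_deriv 1 X) u)
      + v$2 *\<^sub>R (v$1 *\<^sub>R partial_deriv 1 (partial_deriv 2 X) u + v$2 *\<^sub>R partial_deriv 2 (partial_deriv 2 X) u)) (at 0)"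
    unfolding \<gamma>'_def
    using has_vector_derivative_along_line[OF \<open>open U\<close> diff(2), of u 0 v] u
    by (intro has_vector_derivative_add bounded_linear.has_vector_derivative[OF bounded_linear_scaleR_right]) auto
  \<comment> \<open>The mixed derivatives arise once in each order; after commuting they merge into
    one term with coefficient \<open>2 * v$1 * v$2\<close>.\<close>
  moreover have cross_term: "(2 * v$1 * v$2) *\<^sub>R z = (v$1 * v$2) *\<^sub>R z + (v$2 * v$1) *\<^sub>R z" for z :: 'b
    by (simp flip: scaleR_left_distrib)
  ultimately have d\<gamma>': "(\<gamma>' has_vector_derivative Z) (at 0)"
    unfolding Z_def cross_term by (simp add: partial_deriv_commute[OF \<open>open U\<close> C2 u]
        scaleR_add_right power2_eq_square add.assoc)
  define g where "g = (\<lambda>t. \<gamma> t \<bullet> \<gamma> t - P (e \<bullet> \<gamma> t))"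
  define g' where "g' = (\<lambda>t. 2 * (\<gamma> t \<bullet> \<gamma>' t) - P' (e \<bullet> \<gamma> t) * (e \<bullet> \<gamma>' t))"
  have inner: "((\<lambda>t. A t \<bullet> B t) has_real_derivative A t \<bullet> B' + A' \<bullet> B t) (at t)"
    if "(A has_vector_derivative A') (at t)" "(B has_vector_derivative B') (at t)"
    for A B :: "real \<Rightarrow> 'b" and A' B' t
    unfolding has_field_derivative_def
    by (rule has_derivative_eq_rhs[OF has_derivative_inner[OF that[unfolded has_vector_derivative_def]]])
      (simp add: fun_eq_iff algebra_simps)
  have ei: "((\<lambda>t. e \<bullet> B t) has_real_derivative e \<bullet> B') (at t)"
    if "(B has_vector_derivative B') (at t)" for B :: "real \<Rightarrow> 'b" and B' t
    using inner[OF has_vector_derivative_const that, of e] by simp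
  have "(g has_real_derivative g' t) (at t)" if "\<bar>t\<bar> < \<delta>" for t
    unfolding g_def g'_def
    using DERIV_diff[OF inner[OF d\<gamma> d\<gamma>] DERIV_chain2[OF P(1) ei[OF d\<gamma>]], OF that that that]
    by (simp add: inner_commute)
  moreover have "(g' has_real_derivative 2 * (y \<bullet> Z + Y \<bullet> Y) - (P' (e \<bullet> y) * (e \<bullet> Z) + P'' (e \<bullet> y) * (e \<bullet> Y) * (e \<bullet> Y))) (at 0)"
    unfolding g'_def at0[symmetric] using \<open>\<delta> > 0\<close>
    by (intro DERIV_diff DERIV_cmult inner d\<gamma> d\<gamma>' DERIV_mult' ei DERIV_chain2[OF P(2)]) auto
  moreover have "g t \<le> g 0" if "\<bar>t\<bar> < \<delta>" for t
    using max[OF \<delta>[OF that]] by (simp add: g_def \<gamma>_def)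
  ultimately have "g' 0 = 0"
    and "2 * (y \<bullet> Z + Y \<bullet> Y) - (P' (e \<bullet> y) * (e \<bullet> Z) + P'' (e \<bullet> y) * (e \<bullet> Y) * (e \<bullet> Y)) \<le> 0"
    using second_derivative_nonpos_at_max \<open>\<delta> > 0\<close> by blast+
  then show "w \<bullet> Y = 0" "2 * (Y \<bullet> Y) - P'' (e \<bullet> y) * (e \<bullet> Y)\<^sup>2 + w \<bullet> Z \<le> 0"
    by (simp_all add: g'_def at0 w_def inner_diff_left power2_eq_square algebra_simps)
qed

section \<open>Maximum principle for minimal immersions\<close>

lemma norm_cross_squared: "(norm (cross3 x y))\<^sup>2 = (x \<bullet> x) * (y \<bullet> y) - (x \<bullet> y)\<^sup>2"
  using norm_cross_dot[of x y] by (simp add: power_mult_distrib power2_norm_eq_inner)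

lemma cross_nonzero_if_inj:
  fixes X :: "real^2 \<Rightarrow> real^3"
  assumes "open U" "X differentiable_on U" "u \<in> U" "inj (frechet_derivative X (at u))"
  shows "cross3 (partial_deriv 1 X u) (partial_deriv 2 X u) \<noteq> 0"
proof
  have D: "frechet_derivative X (at u) = (\<lambda>v. v$1 *\<^sub>R partial_deriv 1 X u + v$2 *\<^sub>R partial_deriv 2 X u)"
    by (rule frechet_derivative_at[OF has_derivative_partial_deriv[OF assms(1-3)], symmetric])
  define x y where "x = partial_deriv 1 X u" and "y = partial_deriv 2 X u"
  have inj: "v = 0" if "v$1 *\<^sub>R x + v$2 *\<^sub>R y = 0" for v :: "real^2"
    using injD[OF assms(4), of v 0] that by (simp add: D x_def y_def)
  assume "cross3 (partial_deriv 1 X u) (partial_deriv 2 X u) = 0"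
  then have "collinear {0, x, y}"
    by (simp add: cross_eq_0 x_def y_def)
  then have "x = 0 \<or> (\<exists>c. y = c *\<^sub>R x)"
    by (metis collinear_lemma scaleR_zero_left)
  then consider "x = 0" | c where "y = c *\<^sub>R x"
    by blast
  then show False
  proof cases
    case 1
    with inj[of "axis 1 1"] show False by (simp add: axis_def vec_eq_iff forall_2)
  next
    case (2 c)
    with inj[of "vector [c, -1]"] show False by (auto simp: vec_eq_iff forall_2)
  qed
qed

text \<open>Two denominators are cleared: the norm of the cross product in the unit normal, and
  twice the determinant of the metric, which is twice the square of that norm.\<close>

lemma mean_curvature_zero_iff:
  fixes X :: "real^2 \<Rightarrow> real^3"
  defines "x \<equiv> \<lambda>u. partial_deriv 1 X u" and "y \<equiv> \<lambda>u. partial_deriv 2 X u"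
  assumes "cross3 (x u) (y u) \<noteq> 0"
  shows "mean_curvature X u = 0 \<longleftrightarrow> cross3 (x u) (y u) \<bullet>
    ((y u \<bullet> y u) *\<^sub>R partial_deriv 1 x u - (2 * (x u \<bullet> y u)) *\<^sub>R partial_deriv 1 y u
      + (x u \<bullet> x u) *\<^sub>R partial_deriv 2 y u) = 0"
proof -
  define c where "c = cross3 (x u) (y u)"
  define D where "D = (x u \<bullet> x u) * (y u \<bullet> y u) - (x u \<bullet> y u)\<^sup>2"
  define Y where "Y = (y u \<bullet> y u) *\<^sub>R partial_deriv 1 x u - (2 * (x u \<bullet> y u)) *\<^sub>R partial_deriv 1 y u
      + (x u \<bullet> x u) *\<^sub>R partial_deriv 2 y u"
  have "D \<noteq> 0"
    using assms(3) norm_cross_squared[of "x u" "y u"] unfolding D_def by (metis norm_eq_zero zero_eq_power2)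
  have sgn_c: "z \<bullet> sgn c = (c \<bullet> z) / norm c" for z
    by (simp add: sgn_div_norm divide_inverse mult.commute inner_commute)
  have "mean_curvature X u = (c \<bullet> Y) / norm c / (2 * D)"
    unfolding mean_curvature_def first_fundamental_form_def second_fundamental_form_def
      unit_normal_def Let_def x_def[symmetric] y_def[symmetric] c_def[symmetric] sgn_c
    by (simp add: D_def Y_def inner_diff_right inner_add_right add_divide_distrib diff_divide_distrib
      algebra_simps)
  moreover have "norm c \<noteq> 0"
    using assms(3) by (simp add: c_def)
  ultimately show ?thesis
    using \<open>D \<noteq> 0\<close> unfolding c_def[symmetric] Y_def[symmetric] by simp
qed

text \<open>Adding the second derivative inequalities in the directions \<open>(g\<^sub>2\<^sub>2, -g\<^sub>1\<^sub>2)\<close> and \<open>(0, 1)\<close>,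
  with weights \<open>1\<close> and \<open>det g\<close>, produces the trace with respect to the metric.\<close>

lemma trace_inequality_at_max:
  fixes X :: "real^2 \<Rightarrow> real^3"
  assumes "open U" and C2: "Ck_on 2 X U" and u: "u \<in> U"
    and inj: "inj (frechet_derivative X (at u))" and H: "mean_curvature X u = 0"
    and P: "\<And>s. (P has_real_derivative P' s) (at s)" "\<And>s. (P' has_real_derivative P'' s) (at s)"
    and max: "\<And>v. v \<in> U \<Longrightarrow> (X v - a) \<bullet> (X v - a) - P (e \<bullet> (X v - a)) \<le> (X u - a) \<bullet> (X u - a) - P (e \<bullet> (X u - a))"
    and e: "norm e = 1"
  defines "s \<equiv> e \<bullet> (X u - a)"
  defines "r2 \<equiv> (X u - a) \<bullet> (X u - a) - s\<^sup>2"
  assumes "r2 > 0"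
  shows "4 * r2 + (2 * s - P' s)\<^sup>2 \<le> P'' s * r2"
proof -
  define y where "y = X u - a"
  define w where "w = 2 *\<^sub>R y - P' s *\<^sub>R e"
  define x1 where "x1 = partial_deriv 1 X u"
  define x2 where "x2 = partial_deriv 2 X u"
  define x11 where "x11 = partial_deriv 1 (partial_deriv 1 X) u"
  define x12 where "x12 = partial_deriv 1 (partial_deriv 2 X) u"
  define x22 where "x22 = partial_deriv 2 (partial_deriv 2 X) u"
  define c where "c = cross3 x1 x2"
  define g11 where "g11 = x1 \<bullet> x1"
  define g12 where "g12 = x1 \<bullet> x2"
  define g22 where "g22 = x2 \<bullet> x2"
  define D where "D = c \<bullet> c"
  have "X differentiable_on U"
    using C2 by (simp add: numeral_2_eq_2)
  then have "c \<noteq> 0"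
    using cross_nonzero_if_inj[OF \<open>open U\<close> _ u inj] by (simp add: c_def x1_def x2_def)
  then have "D > 0" by (simp add: D_def)
  have D: "D = g11 * g22 - g12\<^sup>2"
    by (simp add: D_def c_def g11_def g12_def g22_def norm_cross_squared flip: power2_norm_eq_inner)
  have "x2 \<noteq> 0" using \<open>c \<noteq> 0\<close> by (auto simp: c_def)
  then have "g22 > 0" by (simp add: g22_def)
  have sy: "s = e \<bullet> y" by (simp add: s_def y_def)
  note d = derivatives_at_max[OF \<open>open U\<close> C2 u P max, folded y_def, folded sy, folded w_def x1_def x2_def x11_def x12_def x22_def]
  have w1: "w \<bullet> x1 = 0" and w2: "w \<bullet> x2 = 0"
    using d(1)[of "axis 1 1"] d(1)[of "axis 2 1"] by (simp_all add: axis_def)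
  \<comment> \<open>Being orthogonal to both tangent vectors, \<open>w\<close> is a multiple of
    \<open>c\<close>. This transfers the curvature equation from \<open>c\<close> to
    \<open>w\<close>.\<close>
  have wc: "D *\<^sub>R w = (w \<bullet> c) *\<^sub>R c"
  proof -
    have "cross3 w c = 0"
      using w1 w2 unfolding c_def Lagrange by simp
    moreover have "cross3 c (cross3 w c) = D *\<^sub>R w - (w \<bullet> c) *\<^sub>R c"
      unfolding Lagrange by (simp add: D_def inner_commute)
    ultimately show ?thesis by simp
  qed
  have "c \<bullet> (g22 *\<^sub>R x11 - (2 * g12) *\<^sub>R x12 + g11 *\<^sub>R x22) = 0"
    using mean_curvature_zero_iff[of X u] H \<open>c \<noteq> 0\<close>
    by (simp add: c_def x1_def x2_def x11_def x12_def x22_def g11_def g12_def g22_def)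
  then have "D * (w \<bullet> (g22 *\<^sub>R x11 - (2 * g12) *\<^sub>R x12 + g11 *\<^sub>R x22)) = 0"
    by (metis wc inner_scaleR_left mult_zero_right)
  then have wY: "g22 * (w \<bullet> x11) - 2 * g12 * (w \<bullet> x12) + g11 * (w \<bullet> x22) = 0"
    using \<open>D > 0\<close> by (simp add: inner_diff_right inner_add_right)
  define Q where "Q = g22 * (e \<bullet> x1)\<^sup>2 - 2 * g12 * (e \<bullet> x1) * (e \<bullet> x2) + g11 * (e \<bullet> x2)\<^sup>2"
  \<comment> \<open>\<open>Q / D\<close> is the squared length of the tangential part of
    \<open>e\<close>, hence \<open>1\<close> minus that of its normal part; the double cross product
    turns this into algebra.\<close>
  have Q: "Q = D - (e \<bullet> c)\<^sup>2"
  proof -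
    have "cross3 e c \<bullet> cross3 e c = ((e \<bullet> x2) *\<^sub>R x1 - (e \<bullet> x1) *\<^sub>R x2) \<bullet> ((e \<bullet> x2) *\<^sub>R x1 - (e \<bullet> x1) *\<^sub>R x2)"
      unfolding c_def Lagrange ..
    also have "\<dots> = Q"
      by (simp add: Q_def g11_def g12_def g22_def inner_diff_left inner_diff_right inner_commute[of x2 x1] power2_eq_square algebra_simps)
    finally have "cross3 e c \<bullet> cross3 e c = Q" .
    then show ?thesis
      using norm_cross_squared[of e c] e by (simp add: power2_norm_eq_inner D_def norm_eq_1)
  qed
  \<comment> \<open>The tangent vector \<open>g22 *\<^sub>R x1 - g12 *\<^sub>R x2\<close> has
    squared length \<open>g22 * D\<close>.\<close>
  have "2 * (g22 * D) - P'' s * (g22 * (e \<bullet> x1) - g12 * (e \<bullet> x2))\<^sup>2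
     + (g22\<^sup>2 * (w \<bullet> x11) - 2 * g22 * g12 * (w \<bullet> x12) + g12\<^sup>2 * (w \<bullet> x22)) \<le> 0"
    using d(2)[of "vector [g22, - g12]"] unfolding D
    by (simp add: inner_diff_left inner_diff_right inner_add_right inner_commute power2_eq_square algebra_simps
      flip: g11_def g12_def g22_def)
  moreover have "2 * g22 - P'' s * (e \<bullet> x2)\<^sup>2 + w \<bullet> x22 \<le> 0"
    using d(2)[of "vector [0, 1]"] by (simp add: g22_def)
  then have "D * (2 * g22 - P'' s * (e \<bullet> x2)\<^sup>2 + w \<bullet> x22) \<le> 0"
    using \<open>D > 0\<close> by (simp add: mult_le_0_iff)
  ultimately have "g22 * (4 * D - P'' s * Q + (g22 * (w \<bullet> x11) - 2 * g12 * (w \<bullet> x12) + g11 * (w \<bullet> x22))) \<le> 0"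
    unfolding D Q_def by (simp add: power2_eq_square algebra_simps)
  then have "4 * D \<le> P'' s * (D - (e \<bullet> c)\<^sup>2)"
    using \<open>g22 > 0\<close> by (simp add: wY Q mult_le_0_iff)
  \<comment> \<open>Multiplying by \<open>w \<bullet> w\<close> eliminates the unknown normal
    direction: \<open>w\<close> is parallel to \<open>c\<close>, so
    \<open>(e \<bullet> c)\<^sup>2 * (w \<bullet> w)\<close> becomes
    \<open>D * (e \<bullet> w)\<^sup>2\<close>. What remains depends only on the position of the
    point.\<close>
  then have "4 * (D * (w \<bullet> w)) \<le> P'' s * (D * (w \<bullet> w) - (e \<bullet> c)\<^sup>2 * (w \<bullet> w))"
    using mult_right_mono[of _ _ "w \<bullet> w"] by (fastforce simp: algebra_simps)
  moreover have "D * (w \<bullet> w) = (w \<bullet> c)\<^sup>2"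
    using arg_cong[OF wc, of "(\<bullet>) w"] by (simp add: power2_eq_square)
  moreover have "D * (e \<bullet> w) = (w \<bullet> c) * (e \<bullet> c)"
    using arg_cong[OF wc, of "(\<bullet>) e"] by simp
  then have "D * ((e \<bullet> c)\<^sup>2 * (w \<bullet> w)) = D * (D * (e \<bullet> w)\<^sup>2)"
    using \<open>D * (w \<bullet> w) = (w \<bullet> c)\<^sup>2\<close> by algebra
  then have "(e \<bullet> c)\<^sup>2 * (w \<bullet> w) = D * (e \<bullet> w)\<^sup>2"
    using \<open>D > 0\<close> by simp
  ultimately have "4 * (D * (w \<bullet> w)) \<le> P'' s * (D * (w \<bullet> w) - D * (e \<bullet> w)\<^sup>2)"
    by simp
  then have "D * (4 * (w \<bullet> w)) \<le> D * (P'' s * (w \<bullet> w - (e \<bullet> w)\<^sup>2))"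
    by (simp add: algebra_simps)
  then have "4 * (w \<bullet> w) \<le> P'' s * (w \<bullet> w - (e \<bullet> w)\<^sup>2)"
    using \<open>D > 0\<close> by simp
  moreover have "e \<bullet> w = 2 * s - P' s"
    using e by (simp add: w_def s_def y_def inner_diff_right norm_eq_1)
  moreover have "w \<bullet> w = 4 * r2 + (2 * s - P' s)\<^sup>2"
    using e by (simp add: w_def r2_def s_def y_def[symmetric] inner_diff_right inner_diff_left norm_eq_1 inner_commute power2_eq_square algebra_simps)
  ultimately show ?thesis by (simp add: algebra_simps)
qed

section \<open>Minimal surfaces in a cone\<close>

lemma surface_interior_subset: "surface_interior S \<subseteq> topspace S"
  by (auto simp: surface_interior_def dest: openin_subset)

lemma minimal_surface_chart:
  assumes "minimal_surface S F" "p \<in> surface_interior S"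
  obtains U X u where "open U" "Ck_on 2 X U" "u \<in> U" "X u = F p" "X ` U \<subseteq> F ` topspace S"
    "inj (frechet_derivative X (at u))" "mean_curvature X u = 0"
proof -
  obtain U W \<phi> where "open U" "openin S W" "p \<in> W"
    and \<phi>: "homeomorphic_map (top_of_set U) (subtopology S W) \<phi>"
    and C2: "Ck_on 2 (F \<circ> \<phi>) U"
    and X: "\<forall>u \<in> U. inj (frechet_derivative (F \<circ> \<phi>) (at u)) \<and> mean_curvature (F \<circ> \<phi>) u = 0"
    using assms unfolding minimal_surface_def by blast
  have "\<phi> ` U = topspace S \<inter> W"
    using homeomorphic_imp_surjective_map[OF \<phi>] by simp
  moreover have "p \<in> topspace S"
    using assms(2) by (rule subsetD[OF surface_interior_subset])
  ultimately have "(F \<circ> \<phi>) ` U \<subseteq> F ` topspace S" and "p \<in> \<phi> ` U"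
    using \<open>p \<in> W\<close> by auto
  then obtain u where "u \<in> U" "\<phi> u = p" "(F \<circ> \<phi>) ` U \<subseteq> F ` topspace S"
    by blast
  with that[of U "F \<circ> \<phi>" u] \<open>open U\<close> C2 X show thesis by simp
qed

text \<open>At a contact point the function \<open>y \<bullet> y - P (e \<bullet> y)\<close>, whose
  zero set contains the barrier, attains its maximum \<open>0\<close> on a chart. With
  \<open>m\<close> the radius of the barrier at height \<open>s\<close> and \<open>n\<close> its
  derivative there, the trace inequality reduces to
  \<open>2 + 2 * n\<^sup>2 \<le> 4 * k + n\<^sup>2\<close>, which fails for
  \<open>k < 1/2\<close>.\<close>

lemma interior_point_not_on_barrier:
  fixes e a :: "real^3"
  assumes "minimal_surface S F" "p \<in> surface_interior S" "norm e = 1" "0 < k" "k < 1/2" "0 < \<mu>"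
    and barrier: "\<And>q. q \<in> topspace S \<Longrightarrow>
      (norm (F q - a))\<^sup>2 - (e \<bullet> (F q - a))\<^sup>2 \<le> (\<mu> + k * (e \<bullet> (F q - a))\<^sup>2 / \<mu>)\<^sup>2"
  shows "(norm (F p - a))\<^sup>2 - (e \<bullet> (F p - a))\<^sup>2 \<noteq> (\<mu> + k * (e \<bullet> (F p - a))\<^sup>2 / \<mu>)\<^sup>2"
proof
  define s where "s = e \<bullet> (F p - a)"
  define m where "m = \<mu> + k * s\<^sup>2 / \<mu>"
  define n where "n = 2 * k * s / \<mu>"
  assume "(norm (F p - a))\<^sup>2 - (e \<bullet> (F p - a))\<^sup>2 = (\<mu> + k * (e \<bullet> (F p - a))\<^sup>2 / \<mu>)\<^sup>2"
  then have r: "(F p - a) \<bullet> (F p - a) - s\<^sup>2 = m\<^sup>2"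
    by (simp add: s_def m_def power2_norm_eq_inner)
  obtain U X u where X: "open U" "Ck_on 2 X U" "u \<in> U" "X u = F p" "X ` U \<subseteq> F ` topspace S"
    "inj (frechet_derivative X (at u))" "mean_curvature X u = 0"
    using minimal_surface_chart[OF assms(1,2)] .
  define P where "P = (\<lambda>s. s\<^sup>2 + (\<mu> + k * s\<^sup>2 / \<mu>)\<^sup>2)"
  define P' where "P' = (\<lambda>s. 2 * s + 2 * (\<mu> + k * s\<^sup>2 / \<mu>) * (2 * k * s / \<mu>))"
  define P'' where "P'' = (\<lambda>s. 2 + 2 * (2 * k * s / \<mu>)\<^sup>2 + 2 * (\<mu> + k * s\<^sup>2 / \<mu>) * (2 * k / \<mu>))"
  have P: "(P has_real_derivative P' s) (at s)" "(P' has_real_derivative P'' s) (at s)" for s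
    unfolding P_def P'_def P''_def using \<open>0 < \<mu>\<close>
    by (auto intro!: derivative_eq_intros simp: power2_eq_square) (simp add: field_simps)
  have max: "(X v - a) \<bullet> (X v - a) - P (e \<bullet> (X v - a)) \<le> (X u - a) \<bullet> (X u - a) - P (e \<bullet> (X u - a))"
    if "v \<in> U" for v
  proof -
    obtain q where q: "q \<in> topspace S" "X v = F q"
      using X(5) \<open>v \<in> U\<close> by blast
    have "(X v - a) \<bullet> (X v - a) - P (e \<bullet> (X v - a)) \<le> 0"
      using barrier[OF q(1)] by (simp add: P_def q(2) power2_norm_eq_inner)
    also have "0 = (X u - a) \<bullet> (X u - a) - P (e \<bullet> (X u - a))"
      using r by (simp add: P_def X(4) s_def m_def)
    finally show ?thesis .
  qed
  have "m > 0"
    using \<open>0 < \<mu>\<close> \<open>0 < k\<close> by (simp add: m_def add_pos_nonneg)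
  then have "4 * m\<^sup>2 + (2 * s - P' s)\<^sup>2 \<le> P'' s * m\<^sup>2"
    using trace_inequality_at_max[OF X(1-3,6,7) P max \<open>norm e = 1\<close>] r
    unfolding X(4) s_def[symmetric] by simp
  moreover have "2 * s - P' s = - (2 * m * n)" "P'' s = 2 + 2 * n\<^sup>2 + 4 * k * (m / \<mu>)"
    by (simp_all add: P'_def P''_def m_def n_def)
  ultimately have "4 * m\<^sup>2 + (- (2 * m * n))\<^sup>2 \<le> (2 + 2 * n\<^sup>2 + 4 * k * (m / \<mu>)) * m\<^sup>2"
    by simp
  then have "m\<^sup>2 * (4 + 4 * n\<^sup>2) \<le> m\<^sup>2 * (2 + 2 * n\<^sup>2 + 4 * k * (m / \<mu>))"
    by (simp add: power_mult_distrib algebra_simps)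
  then have "2 + 2 * n\<^sup>2 \<le> 4 * k * (m / \<mu>)"
    using \<open>m > 0\<close> by simp
  also have "4 * k * (m / \<mu>) = 4 * k + n\<^sup>2"
    using \<open>0 < \<mu>\<close> by (simp add: m_def n_def power2_eq_square field_simps)
  finally show False
    using \<open>k < 1/2\<close> zero_le_power2[of n] by linarith
qed

text \<open>If the surface had points other than \<open>a\<close> on or outside the cone, one with
  the largest barrier parameter would exist by compactness. The corresponding barrier encloses the
  whole surface and touches it there. The point is not on the boundary, which lies strictly inside
  the cone, so the contact is impossible.\<close>

lemma minimal_surface_in_cone:
  fixes e a :: "real^3"
  assumes S: "minimal_surface S F" "compact_space S" and e: "norm e = 1" and k: "0 < k" "k < 1/2"
    and boundary: "\<And>p. p \<in> surface_boundary S \<Longrightarrow>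
      (norm (F p - a))\<^sup>2 - (e \<bullet> (F p - a))\<^sup>2 < 4 * k * (e \<bullet> (F p - a))\<^sup>2"
    and p: "p \<in> topspace S" "F p \<noteq> a"
  shows "(norm (F p - a))\<^sup>2 - (e \<bullet> (F p - a))\<^sup>2 < 4 * k * (e \<bullet> (F p - a))\<^sup>2"
proof (rule ccontr)
  define s where "s = (\<lambda>x. e \<bullet> (x - a))"
  define r2 where "r2 = (\<lambda>x. (norm (x - a))\<^sup>2 - (s x)\<^sup>2)"
  assume "\<not> ?thesis"
  then have p': "4 * k * (s (F p))\<^sup>2 \<le> r2 (F p)"
    by (simp add: s_def r2_def)
  define K where "K = F ` topspace S"
  have "compact K"
    using S image_compactin[of S "topspace S" euclidean F]
    by (simp add: K_def minimal_surface_def compact_space_def)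
  define K' where "K' = K \<inter> {x. 4 * k * (s x)\<^sup>2 \<le> r2 x}"
  \<comment> \<open>\<open>L x / 2\<close> is the larger of the two parameters \<open>\<mu>\<close> whose barrier passes through \<open>x\<close>, that is,
    the larger root of \<open>\<mu>\<^sup>2 - r \<mu> + k z\<^sup>2 = 0\<close>.\<close>
  define L where "L = (\<lambda>x. sqrt (r2 x) + sqrt (r2 x - 4 * k * (s x)\<^sup>2))"
  have cont: "continuous_on A s" "continuous_on A r2" for A
    unfolding r2_def s_def by (intro continuous_intros)+
  have "compact K'"
    unfolding K'_def using cont
    by (intro compact_Int_closed \<open>compact K\<close> closed_Collect_le continuous_intros)
  moreover have Fp: "F p \<in> K'"
    using p p' by (simp add: K'_def K_def)
  moreover have "continuous_on K' L"
    unfolding L_def by (intro continuous_intros cont)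
  ultimately obtain x where x: "x \<in> K'" and max: "\<And>y. y \<in> K' \<Longrightarrow> L y \<le> L x"
    using continuous_attains_sup[of K' L] by blast
  have r2_nonneg: "r2 y \<ge> 0" for y
    using Cauchy_Schwarz_ineq[of e "y - a"] e by (simp add: r2_def s_def power2_norm_eq_inner norm_eq_1)
  \<comment> \<open>Only the vertex is on or outside the cone with zero distance from the axis, so
    \<open>F p \<noteq> a\<close> makes the parameter \<open>\<mu>\<close> positive and the barrier
    nondegenerate.\<close>
  have "L (F p) > 0"
  proof -
    have "r2 (F p) > 0"
    proof (rule ccontr)
      assume "\<not> r2 (F p) > 0"
      with r2_nonneg[of "F p"] have "r2 (F p) = 0" by simp
      moreover from this have "s (F p) = 0"
        using p' k by (simp add: mult_le_0_iff)
      ultimately show False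
        using p by (simp add: r2_def)
    qed
    moreover have "sqrt (r2 (F p) - 4 * k * (s (F p))\<^sup>2) \<ge> 0"
      using p' by simp
    ultimately show ?thesis
      unfolding L_def by (simp add: add_pos_nonneg)
  qed
  then have "L x > 0"
    using max[OF Fp] by simp
  define \<mu> where "\<mu> = L x / 2"
  have "\<mu> > 0" using \<open>L x > 0\<close> by (simp add: \<mu>_def)
  define m where "m = (\<lambda>y. \<mu> + k * (s y)\<^sup>2 / \<mu>)"
  have m_pos: "m y > 0" for y
    using k \<open>\<mu> > 0\<close> by (simp add: m_def add_pos_nonneg)
  \<comment> \<open>The left side is the quadratic
    \<open>\<mu>\<^sup>2 - r * \<mu> + k * z\<^sup>2\<close> with \<open>r = sqrt (r2 y)\<close> and
    \<open>z = s y\<close>, and the right side completes the square. Its sign tells on which side of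
    the barrier \<open>y\<close> lies.\<close>
  have discr: "\<mu> * (m y - sqrt (r2 y)) = (\<mu> - sqrt (r2 y) / 2)\<^sup>2 - (sqrt (r2 y - 4 * k * (s y)\<^sup>2) / 2)\<^sup>2"
    if "y \<in> K'" for y
  proof -
    have "(sqrt (r2 y - 4 * k * (s y)\<^sup>2))\<^sup>2 = (sqrt (r2 y))\<^sup>2 - 4 * k * (s y)\<^sup>2"
      using that r2_nonneg[of y] by (simp add: K'_def)
    then show ?thesis
      using \<open>\<mu> > 0\<close> by (simp add: m_def power_divide power2_diff) (simp add: field_simps power2_eq_square)
  qed
  have barrier: "r2 y \<le> (m y)\<^sup>2" if "y \<in> K" for y
  proof (cases "y \<in> K'")
    case True
    define q where "q = sqrt (r2 y - 4 * k * (s y)\<^sup>2) / 2"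
    \<comment> \<open>By maximality of \<open>L x\<close>, the parameter \<open>\<mu>\<close> is at
      least the larger root belonging to \<open>y\<close>, where the quadratic is
      nonnegative.\<close>
    have "0 \<le> q" "q \<le> \<mu> - sqrt (r2 y) / 2"
      using True max[OF True] by (simp_all add: q_def \<mu>_def L_def K'_def field_simps)
    then have "q\<^sup>2 \<le> (\<mu> - sqrt (r2 y) / 2)\<^sup>2"
      by (intro power_mono)
    then have "0 \<le> \<mu> * (m y - sqrt (r2 y))"
      using discr[OF True] by (simp add: q_def)
    then have "sqrt (r2 y) \<le> m y"
      using \<open>\<mu> > 0\<close> by (simp add: zero_le_mult_iff)
    then show ?thesis
      by (rule sqrt_le_D)
  next
    case False
    then have "r2 y \<le> 4 * k * (s y)\<^sup>2"
      using that by (simp add: K'_def)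
    \<comment> \<open>The closed cone lies inside every barrier: this is the inequality of
      arithmetic and geometric means for \<open>\<mu>\<close> and
      \<open>k * (s y)\<^sup>2 / \<mu>\<close>.\<close>
    also have "\<dots> = (m y)\<^sup>2 - (\<mu> - k * (s y)\<^sup>2 / \<mu>)\<^sup>2"
      using \<open>\<mu> > 0\<close> by (simp add: m_def power2_sum power2_diff)
    finally show ?thesis
      by (smt (verit) zero_le_power2)
  qed
  obtain p' where p': "p' \<in> topspace S" "F p' = x"
    using x by (auto simp: K'_def K_def)
  have root: "\<mu> - sqrt (r2 x) / 2 = sqrt (r2 x - 4 * k * (s x)\<^sup>2) / 2"
    by (simp add: \<mu>_def L_def field_simps)
  then have "sqrt (r2 x) = m x"
    using discr[OF x, unfolded root] \<open>\<mu> > 0\<close> by simp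
  then have touch: "r2 x = (m x)\<^sup>2"
    using r2_nonneg[of x] by (metis real_sqrt_pow2)
  have "p' \<notin> surface_boundary S"
    using boundary[of p'] x by (auto simp: p'(2) K'_def r2_def s_def)
  then have "p' \<in> surface_interior S"
    using p' by (simp add: surface_boundary_def)
  from interior_point_not_on_barrier[OF S(1) this e k \<open>\<mu> > 0\<close>, of a]
  show False
    using barrier touch by (auto simp: p'(2) K_def r2_def m_def s_def)
qed

text \<open>A tangent plane at the vertex would contain a nonzero direction orthogonal to
  \<open>e\<close>. The function \<open>y \<bullet> y - C * (e \<bullet> y)\<^sup>2\<close> is
  maximal at the vertex and its gradient vanishes there, so its second derivative in that direction
  forces the tangent vector to be zero, against injectivity of the differential.\<close>

lemma interior_point_not_vertex:
  fixes e a :: "real^3"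
  assumes S: "minimal_surface S F" and p: "p \<in> surface_interior S"
    and cone: "\<And>q. q \<in> topspace S \<Longrightarrow> (norm (F q - a))\<^sup>2 \<le> C * (e \<bullet> (F q - a))\<^sup>2"
  shows "F p \<noteq> a"
proof
  assume "F p = a"
  obtain U X u where X: "open U" "Ck_on 2 X U" "u \<in> U" "X u = F p" "X ` U \<subseteq> F ` topspace S"
    "inj (frechet_derivative X (at u))" "mean_curvature X u = 0"
    using minimal_surface_chart[OF S p] .
  define x where "x = partial_deriv 1 X u"
  define y where "y = partial_deriv 2 X u"
  have "X differentiable_on U"
    using X(2) by (simp add: numeral_2_eq_2)
  then have D: "frechet_derivative X (at u) = (\<lambda>v. v$1 *\<^sub>R x + v$2 *\<^sub>R y)"
    unfolding x_def y_def
    by (rule frechet_derivative_at[OF has_derivative_partial_deriv[OF X(1) _ X(3)], symmetric])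
  obtain v :: "real^2" where "v \<noteq> 0" and v: "e \<bullet> (v$1 *\<^sub>R x + v$2 *\<^sub>R y) = 0"
  proof (cases "e \<bullet> x = 0")
    case True
    with that[of "axis 1 1"] show thesis by (simp add: axis_def vec_eq_iff forall_2)
  next
    case False
    with that[of "vector [e \<bullet> y, - (e \<bullet> x)]"] show thesis
      by (auto simp: vec_eq_iff forall_2 inner_diff_right)
  qed
  have C: "((\<lambda>s. C * s\<^sup>2) has_real_derivative 2 * C * s) (at s)"
    "((\<lambda>s. 2 * C * s) has_real_derivative 2 * C) (at s)" for s
    by (auto intro!: derivative_eq_intros)
  have "(X v - a) \<bullet> (X v - a) - C * (e \<bullet> (X v - a))\<^sup>2 \<le> (X u - a) \<bullet> (X u - a) - C * (e \<bullet> (X u - a))\<^sup>2"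
    if "v \<in> U" for v
    using cone X(4,5) \<open>F p = a\<close> that by (auto simp: power2_norm_eq_inner image_subset_iff image_iff)
  from derivatives_at_max(2)[OF X(1-3) C this, of v, folded x_def y_def, unfolded v X(4) \<open>F p = a\<close>]
  have "(v$1 *\<^sub>R x + v$2 *\<^sub>R y) \<bullet> (v$1 *\<^sub>R x + v$2 *\<^sub>R y) \<le> 0" by simp
  then have "v$1 *\<^sub>R x + v$2 *\<^sub>R y = 0"
    using inner_gt_zero_iff linorder_not_less by blast
  then have "frechet_derivative X (at u) v = frechet_derivative X (at u) 0"
    by (simp add: D)
  with \<open>v \<noteq> 0\<close> X(6) show False by (auto dest: injD)
qed

text \<open>By connectedness some point has height zero over \<open>a\<close> along
  \<open>e\<close>, and at that height the cone consists of the vertex alone. The strict inequality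
  fails at the vertex, so the point is not on the boundary; an interior point cannot be there
  either.\<close>

lemma no_connected_minimal_surface_in_cone:
  fixes e a :: "real^3"
  assumes S: "minimal_surface S F" "compact_space S" "connected_space S"
    and e: "norm e = 1" and k: "0 < k" "k < 1/2"
    and boundary: "\<And>p. p \<in> surface_boundary S \<Longrightarrow>
      (norm (F p - a))\<^sup>2 - (e \<bullet> (F p - a))\<^sup>2 < 4 * k * (e \<bullet> (F p - a))\<^sup>2"
    and p: "p \<in> topspace S" "e \<bullet> (F p - a) \<ge> 0" and q: "q \<in> topspace S" "e \<bullet> (F q - a) \<le> 0"
  shows False
proof -
  have in_cone: "(norm (F q - a))\<^sup>2 - (e \<bullet> (F q - a))\<^sup>2 < 4 * k * (e \<bullet> (F q - a))\<^sup>2"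
    if "q \<in> topspace S" "F q \<noteq> a" for q
    using minimal_surface_in_cone[OF S(1,2) e k boundary that] .
  have cont: "continuous_map S euclidean F"
    using S(1) by (simp add: minimal_surface_def)
  have "connected (F ` topspace S)"
    using connectedin_continuous_map_image[OF cont, of "topspace S"] S(3)
    by (simp add: connectedin_topspace)
  then have "connected ((\<lambda>x. e \<bullet> (x - a)) ` F ` topspace S)"
    by (intro connected_continuous_image continuous_intros)
  then have "0 \<in> (\<lambda>x. e \<bullet> (x - a)) ` F ` topspace S"
    using p q connectedD_interval[of _ "e \<bullet> (F q - a)" "e \<bullet> (F p - a)" 0] by blast
  then obtain z where z: "z \<in> topspace S" "e \<bullet> (F z - a) = 0" by auto
  have "F z = a"
    using in_cone[OF z(1)] z(2) by fastforce
  then have "z \<notin> surface_boundary S"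
    using boundary[of z] by auto
  then have "z \<in> surface_interior S"
    using z by (simp add: surface_boundary_def)
  moreover have "(norm (F q - a))\<^sup>2 \<le> (1 + 4 * k) * (e \<bullet> (F q - a))\<^sup>2" if "q \<in> topspace S" for q
    using in_cone[OF that] by (cases "F q = a") (auto simp: algebra_simps)
  ultimately show False
    using interior_point_not_vertex[OF S(1)] \<open>F z = a\<close> by blast
qed

section \<open>Curves in parallel planes\<close>

lemma real_set_in_interval:
  fixes A :: "real set"
  assumes "\<And>x y. x \<in> A \<Longrightarrow> y \<in> A \<Longrightarrow> \<bar>x - y\<bar> \<le> d"
  obtains m where "\<And>x. x \<in> A \<Longrightarrow> \<bar>x - m\<bar> \<le> d / 2"
proof (cases "A = {}")
  case True
  then show thesis using that by simp
next
  case False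
  have le: "y \<le> x + d" if "x \<in> A" "y \<in> A" for x y
    using assms[OF that] by linarith
  then have "bdd_above A"
    using False by (meson all_not_in_conv bdd_aboveI)
  \<comment> \<open>All of \<open>A\<close> lies between \<open>Sup A - d\<close> and
    \<open>Sup A\<close>.\<close>
  have "\<bar>x - (Sup A - d / 2)\<bar> \<le> d / 2" if "x \<in> A" for x
  proof -
    have "x \<le> Sup A" "Sup A \<le> x + d"
      using that False le[OF that] \<open>bdd_above A\<close> by (auto intro!: cSup_upper cSup_least)
    then show ?thesis unfolding abs_le_iff by linarith
  qed
  then show thesis by (rule that)
qed

text \<open>The projections to two orthonormal directions \<open>i\<close> and \<open>j\<close> of
  the plane lie in intervals of length \<open>d\<close>. This gives a square of side
  \<open>d\<close>, whose circumscribed disc has squared radius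
  \<open>d\<^sup>2 / 2\<close>.\<close>

lemma planar_set_in_disc:
  fixes C :: "(real^3) set"
  assumes n: "norm n = 1" and plane: "\<And>x. x \<in> C \<Longrightarrow> n \<bullet> x = b"
    and d: "\<And>x y. x \<in> C \<Longrightarrow> y \<in> C \<Longrightarrow> dist x y \<le> d"
  obtains c where "n \<bullet> c = b" "\<And>x. x \<in> C \<Longrightarrow> (norm (x - c))\<^sup>2 \<le> d\<^sup>2 / 2"
proof -
  obtain i :: "real^3" where "norm i = 1" "i \<bullet> n = 0"
  proof -
    obtain y :: "real^3" where "y \<noteq> 0" "orthogonal n y"
      using orthogonal_to_vector_exists[of n] by auto
    then show thesis
      by (intro that[of "sgn y"]) (auto simp: norm_sgn sgn_div_norm orthogonal_def inner_commute)
  qed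
  define j where "j = cross3 n i"
  have j: "norm j = 1" "j \<bullet> n = 0" "j \<bullet> i = 0"
    using norm_cross_dot[of n i] n \<open>norm i = 1\<close> \<open>i \<bullet> n = 0\<close>
    by (auto simp: j_def inner_commute dot_cross_self power2_eq_1_iff)
      (metis norm_ge_zero le_minus_one_simps(3))
  have proj: "\<bar>f \<bullet> x - f \<bullet> y\<bar> \<le> d" if "norm f = 1" "x \<in> C" "y \<in> C" for f x y
    using Cauchy_Schwarz_ineq2[of f "x - y"] d[OF that(2,3)] that(1)
    by (simp add: inner_diff_right dist_norm)
  obtain m1 where m1: "\<And>t. t \<in> (\<bullet>) i ` C \<Longrightarrow> \<bar>t - m1\<bar> \<le> d / 2"
    by (rule real_set_in_interval[of "(\<bullet>) i ` C" d]) (use proj \<open>norm i = 1\<close> in auto)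
  obtain m2 where m2: "\<And>t. t \<in> (\<bullet>) j ` C \<Longrightarrow> \<bar>t - m2\<bar> \<le> d / 2"
    by (rule real_set_in_interval[of "(\<bullet>) j ` C" d]) (use proj j in auto)
  define c where "c = m1 *\<^sub>R i + m2 *\<^sub>R j + b *\<^sub>R n"
  have inner_c: "i \<bullet> c = m1" "j \<bullet> c = m2" "n \<bullet> c = b"
    using n j \<open>norm i = 1\<close> \<open>i \<bullet> n = 0\<close>
    by (simp_all add: c_def inner_add_right inner_commute norm_eq_1)
  have "(norm (x - c))\<^sup>2 \<le> d\<^sup>2 / 2" if "x \<in> C" for x
  proof -
    define w where "w = x - c"
    have "n \<bullet> w = 0"
      using plane[OF that] by (simp add: w_def inner_diff_right inner_c)
    \<comment> \<open>Together with the Lagrange identity for \<open>w\<close> and \<open>j\<close>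
      this yields Pythagoras for \<open>w\<close> in the basis \<open>i\<close>, \<open>j\<close> of
      the plane.\<close>
    then have "cross3 w (cross3 n i) = (i \<bullet> w) *\<^sub>R n"
      unfolding Lagrange by (simp add: inner_commute)
    then have "(norm (cross3 w j))\<^sup>2 = (i \<bullet> w)\<^sup>2"
      using n by (simp add: j_def)
    then have "(norm w)\<^sup>2 = (i \<bullet> w)\<^sup>2 + (j \<bullet> w)\<^sup>2"
      using norm_cross_dot[of w j] j by (simp add: inner_commute)
    also have "\<dots> \<le> (d / 2)\<^sup>2 + (d / 2)\<^sup>2"
      using m1[of "i \<bullet> x"] m2[of "j \<bullet> x"] that
      by (intro add_mono) (auto simp: w_def inner_diff_right inner_c abs_le_square_iff[symmetric])
    finally show ?thesis
      by (simp add: w_def power_divide)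
  qed
  with inner_c(3) that show thesis by blast
qed

text \<open>Here \<open>u\<close> leads from the vertex to the centre of a disc of squared radius
  \<open>R\<close> at height \<open>H\<close>. For a centre straight above the vertex,
  \<open>1 + R / H\<^sup>2\<close> is the constant of the right circular cone over the disc; sliding
  the disc sideways does not require a wider cone once the axis is tilted.\<close>

lemma oblique_cone_axis:
  fixes n u :: "'a::real_inner"
  assumes "norm n = 1" "n \<bullet> u = H" "H > 0" "R \<ge> 0"
  obtains e where "norm e = 1"
    "\<And>w. n \<bullet> w = 0 \<Longrightarrow> (norm w)\<^sup>2 \<le> R \<Longrightarrow>
      0 < e \<bullet> (u + w) \<and> (norm (u + w))\<^sup>2 \<le> (1 + R / H\<^sup>2) * (e \<bullet> (u + w))\<^sup>2"
proof -
  define A where "A = 1 + R / H\<^sup>2"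
  define B where "B = A * H\<^sup>2"
  define \<tau> where "\<tau> = u - H *\<^sub>R n"
  \<comment> \<open>This tilt turns the defect in the cone inequality into a sum of squares.\<close>
  define e where "e = \<tau> + (A * H) *\<^sub>R n"
  define T where "T = \<tau> \<bullet> \<tau>"
  have "A \<ge> 1" and B: "B = R + H\<^sup>2"
    using assms by (simp_all add: A_def B_def field_simps)
  have "B > 0" "T \<ge> 0"
    using assms by (simp_all add: B T_def add_nonneg_pos)
  have \<tau>: "n \<bullet> \<tau> = 0" "\<tau> \<bullet> n = 0"
    using assms by (simp_all add: \<tau>_def inner_diff_right inner_diff_left inner_commute norm_eq_1)
  have nn: "n \<bullet> n = 1"
    using assms by (simp add: norm_eq_1)
  have ee: "e \<bullet> e = T + A * B"
    by (simp add: e_def inner_add_left inner_add_right \<tau> nn T_def B_def power2_eq_square)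
  then have "e \<bullet> e > 0"
    using \<open>A \<ge> 1\<close> \<open>B > 0\<close> \<open>T \<ge> 0\<close> by (simp add: add_nonneg_pos)
  then have "e \<noteq> 0" by auto
  have "0 < sgn e \<bullet> (u + w) \<and> (norm (u + w))\<^sup>2 \<le> A * (sgn e \<bullet> (u + w))\<^sup>2"
    if w: "n \<bullet> w = 0" "(norm w)\<^sup>2 \<le> R" for w
  proof -
    define s where "s = \<tau> \<bullet> w"
    have u: "u = \<tau> + H *\<^sub>R n"
      by (simp add: \<tau>_def)
    have ev: "e \<bullet> (u + w) = T + s + B"
      by (simp add: e_def u inner_add_left inner_add_right \<tau> nn w T_def B_def s_def power2_eq_square)
    have "(u + w) \<bullet> (u + w) = T + 2 * s + (norm w)\<^sup>2 + H\<^sup>2"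
      using w(1) by (simp add: u inner_add_left inner_add_right \<tau> nn T_def s_def power2_norm_eq_inner
        inner_commute[of w \<tau>] inner_commute[of w n] flip: power2_eq_square)
    then have vv: "(u + w) \<bullet> (u + w) \<le> T + 2 * s + B"
      using w by (simp add: B)
    \<comment> \<open>Bounding the mixed term \<open>s\<close> by \<open>T + B\<close> makes
      \<open>e \<bullet> (u + w)\<close> positive, so that the disc lies in a single nappe.\<close>
    have "s\<^sup>2 \<le> T * (norm w)\<^sup>2"
      using Cauchy_Schwarz_ineq[of \<tau> w] by (simp add: s_def T_def power2_norm_eq_inner)
    also have "\<dots> \<le> T * B"
      using w \<open>T \<ge> 0\<close> by (intro mult_left_mono) (simp_all add: B add_increasing2)
    also have "\<dots> < (T + B)\<^sup>2"
      using \<open>T \<ge> 0\<close> \<open>B > 0\<close> by (simp add: power2_sum add_pos_nonneg add_nonneg_pos)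
    finally have "\<bar>s\<bar> < T + B"
      using \<open>T \<ge> 0\<close> \<open>B > 0\<close> by (metis abs_le_square_iff abs_of_nonneg add_nonneg_nonneg less_imp_le linorder_not_le)
    then have "T + s + B > 0" by linarith
    have "(e \<bullet> e) * ((u + w) \<bullet> (u + w)) \<le> (T + A * B) * (T + 2 * s + B)"
      unfolding ee using vv \<open>e \<bullet> e > 0\<close> ee by (intro mult_left_mono) simp_all
    also have "\<dots> = A * (T + s + B)\<^sup>2 - ((A - 1) * ((T + s)\<^sup>2 + T * B) + s\<^sup>2)"
      by (simp add: power2_eq_square algebra_simps)
    also have "\<dots> \<le> A * (T + s + B)\<^sup>2"
    proof -
      have "0 \<le> (A - 1) * ((T + s)\<^sup>2 + T * B)"
        using \<open>A \<ge> 1\<close> \<open>T \<ge> 0\<close> \<open>B > 0\<close> by (intro mult_nonneg_nonneg add_nonneg_nonneg) auto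
      then show ?thesis
        using zero_le_power2[of s] by linarith
    qed
    finally have "(e \<bullet> e) * ((u + w) \<bullet> (u + w)) \<le> A * (T + s + B)\<^sup>2" .
    then have "(norm (u + w))\<^sup>2 \<le> A * ((T + s + B)\<^sup>2 / (norm e)\<^sup>2)"
      using \<open>e \<bullet> e > 0\<close> by (simp add: power2_norm_eq_inner pos_le_divide_eq mult.commute)
    moreover have "sgn e \<bullet> (u + w) = (T + s + B) / norm e"
      by (simp add: sgn_div_norm ev divide_inverse mult.commute)
    ultimately show ?thesis
      using \<open>e \<noteq> 0\<close> \<open>T + s + B > 0\<close> by (simp add: power_divide)
  qed
  with that[of "sgn e"] \<open>e \<noteq> 0\<close> show thesis
    by (simp add: norm_sgn A_def)
qed

lemma parallel_planes:
  fixes P\<^sub>1 P\<^sub>2 :: "(real^3) set"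
  assumes "affine P\<^sub>1" "aff_dim P\<^sub>1 = 2" "affine_parallel P\<^sub>1 P\<^sub>2"
  obtains n b\<^sub>1 b\<^sub>2 where "norm n = 1" "P\<^sub>1 = {x. n \<bullet> x = b\<^sub>1}" "P\<^sub>2 = {x. n \<bullet> x = b\<^sub>2}" "b\<^sub>2 \<le> b\<^sub>1"
proof -
  have "aff_dim P\<^sub>1 = DIM(real^3) - 1"
    using assms(2) by simp
  then obtain m b where "m \<noteq> 0" and P1: "P\<^sub>1 = {x. m \<bullet> x = b}"
    using aff_dim_eq_hyperplane[of P\<^sub>1] assms(1) by (auto simp: hull_same)
  obtain a where P2: "P\<^sub>2 = (+) a ` P\<^sub>1"
    using assms(3) by (auto simp: affine_parallel_def)
  have P2: "P\<^sub>2 = {x. m \<bullet> x = b + m \<bullet> a}"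
    unfolding P1 P2 by (auto simp: inner_add_right image_iff algebra_simps intro!: exI[of _ "_ - a"])
  \<comment> \<open>The factor normalizes the normal vector and orients it so that the translation
    from \<open>P\<^sub>1\<close> to \<open>P\<^sub>2\<close> does not increase the height.\<close>
  define \<sigma> where "\<sigma> = (if m \<bullet> a \<le> 0 then 1 else -1) / norm m"
  have "\<sigma> \<noteq> 0" and norm: "norm (\<sigma> *\<^sub>R m) = 1" and le: "\<sigma> * (m \<bullet> a) \<le> 0"
    using \<open>m \<noteq> 0\<close> by (auto simp: \<sigma>_def divide_le_0_iff)
  have "P\<^sub>1 = {x. (\<sigma> *\<^sub>R m) \<bullet> x = \<sigma> * b}" "P\<^sub>2 = {x. (\<sigma> *\<^sub>R m) \<bullet> x = \<sigma> * (b + m \<bullet> a)}"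
    using \<open>\<sigma> \<noteq> 0\<close> by (simp_all add: P1 P2)
  then show thesis
    by (rule that[OF norm]) (use le in \<open>simp add: distrib_left\<close>)
qed

lemma setdist_hyperplanes_le:
  fixes n :: "'a::real_inner"
  assumes "norm n = 1"
  shows "setdist {x. n \<bullet> x = b} {x. n \<bullet> x = c} \<le> \<bar>b - c\<bar>"
proof -
  have "setdist {x. n \<bullet> x = b} {x. n \<bullet> x = c} \<le> dist (b *\<^sub>R n) (c *\<^sub>R n)"
    using assms by (intro setdist_le_dist) (simp_all add: norm_eq_1)
  also have "\<dots> = \<bar>b - c\<bar>"
    using assms by (simp add: dist_norm flip: scaleR_left_diff_distrib)
  finally show ?thesis .
qed

theorem corollary4p1:
  fixes S :: "'a topology" and F :: "'a \<Rightarrow> real^3"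
    and C\<^sub>1 C\<^sub>2 P\<^sub>1 P\<^sub>2 :: "(real^3) set" and d\<^sub>1 d\<^sub>2 h :: real
  assumes "closed_curve C\<^sub>1" and "closed_curve C\<^sub>2"
    and "d\<^sub>1 = diameter C\<^sub>1" and "d\<^sub>2 = diameter C\<^sub>2"
    and "affine P\<^sub>1" and "aff_dim P\<^sub>1 = 2" and "affine P\<^sub>2" and "aff_dim P\<^sub>2 = 2"
    and "affine_parallel P\<^sub>1 P\<^sub>2"
    and "C\<^sub>1 \<subseteq> P\<^sub>1" and "C\<^sub>2 \<subseteq> P\<^sub>2"
    and "h = setdist P\<^sub>1 P\<^sub>2"
    and "minimal_surface S F"
    and "compact_space S" and "connected_space S"
    and "F ` surface_boundary S = C\<^sub>1 \<union> C\<^sub>2"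
  shows "h \<le> max d\<^sub>1 d\<^sub>2"
proof (rule ccontr)
  define d where "d = max d\<^sub>1 d\<^sub>2"
  assume "\<not> h \<le> max d\<^sub>1 d\<^sub>2"
  then have "d < h" unfolding d_def by (rule not_le_imp_less)
  have C: "C\<^sub>1 \<noteq> {}" "bounded C\<^sub>1" "C\<^sub>2 \<noteq> {}" "bounded C\<^sub>2"
    using assms(1,2) by (auto simp: closed_curve_def bounded_path_image)
  have dist: "dist x y \<le> d" if "x \<in> C\<^sub>1 \<and> y \<in> C\<^sub>1 \<or> x \<in> C\<^sub>2 \<and> y \<in> C\<^sub>2" for x y
    using that C diameter_bounded_bound[of C\<^sub>1 x y] diameter_bounded_bound[of C\<^sub>2 x y] assms(3,4)
    by (auto simp: d_def)
  then have "d \<ge> 0"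
    using C by (metis all_not_in_conv dist_self)
  obtain n b\<^sub>1 b\<^sub>2 where n: "norm n = 1" and P: "P\<^sub>1 = {x. n \<bullet> x = b\<^sub>1}" "P\<^sub>2 = {x. n \<bullet> x = b\<^sub>2}"
    and "b\<^sub>2 \<le> b\<^sub>1"
    using parallel_planes assms(5,6,9) by metis
  define H where "H = (b\<^sub>1 - b\<^sub>2) / 2"
  have "h \<le> 2 * H"
    using setdist_hyperplanes_le[OF n, of b\<^sub>1 b\<^sub>2] \<open>b\<^sub>2 \<le> b\<^sub>1\<close> assms(12) by (simp add: P H_def)
  then have "d < 2 * H" "H > 0"
    using \<open>d < h\<close> \<open>d \<ge> 0\<close> by linarith+
  obtain c\<^sub>1 where c1: "n \<bullet> c\<^sub>1 = b\<^sub>1" "\<And>x. x \<in> C\<^sub>1 \<Longrightarrow> (norm (x - c\<^sub>1))\<^sup>2 \<le> d\<^sup>2 / 2"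
    using planar_set_in_disc[OF n, of C\<^sub>1 b\<^sub>1 d] assms(10) dist P by blast
  obtain c\<^sub>2 where c2: "n \<bullet> c\<^sub>2 = b\<^sub>2" "\<And>x. x \<in> C\<^sub>2 \<Longrightarrow> (norm (x - c\<^sub>2))\<^sup>2 \<le> d\<^sup>2 / 2"
    using planar_set_in_disc[OF n, of C\<^sub>2 b\<^sub>2 d] assms(11) dist P by blast
  \<comment> \<open>The centres are \<open>a + u\<close> and \<open>a - u\<close>, at heights
    \<open>H\<close> and \<open>-H\<close> over \<open>a\<close>, so a single axis \<open>e\<close>
    serves both discs.\<close>
  define a where "a = (1/2) *\<^sub>R (c\<^sub>1 + c\<^sub>2)"
  define u where "u = (1/2) *\<^sub>R (c\<^sub>1 - c\<^sub>2)"
  \<comment> \<open>This is the squared slope of the cone over a disc of squared radius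
    \<open>d\<^sup>2 / 2\<close> at height \<open>H\<close>. The assumption \<open>d < h\<close>
    gives \<open>d < 2 * H\<close>, which is the same as \<open>q < 2\<close>, the critical value
    for the barriers.\<close>
  define q where "q = d\<^sup>2 / 2 / H\<^sup>2"
  have "n \<bullet> u = H"
    using c1 c2 by (simp add: u_def H_def inner_diff_right)
  then obtain e where e: "norm e = 1"
    and cone: "\<And>w. n \<bullet> w = 0 \<Longrightarrow> (norm w)\<^sup>2 \<le> d\<^sup>2 / 2 \<Longrightarrow>
      0 < e \<bullet> (u + w) \<and> (norm (u + w))\<^sup>2 \<le> (1 + q) * (e \<bullet> (u + w))\<^sup>2"
    using oblique_cone_axis[OF n _ \<open>H > 0\<close>, of u "d\<^sup>2 / 2"] unfolding q_def by auto
  have "d\<^sup>2 < (2 * H)\<^sup>2"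
    using \<open>d < 2 * H\<close> \<open>d \<ge> 0\<close> by (intro power_strict_mono) auto
  then have "0 \<le> q" "q < 2"
    using \<open>H > 0\<close> by (simp_all add: q_def field_simps)
  \<comment> \<open>The value \<open>4 * k\<close> is midway between \<open>q\<close> and
    \<open>2\<close>: this leaves strict room for the boundary inside the cone and keeps
    \<open>k < 1/2\<close>. It is positive also when \<open>d = 0\<close>.\<close>
  define k where "k = (q + 2) / 8"
  have k: "0 < k" "k < 1/2" "q < 4 * k"
    using \<open>0 \<le> q\<close> \<open>q < 2\<close> by (simp_all add: k_def)
  have strict: "(norm v)\<^sup>2 - (e \<bullet> v)\<^sup>2 < 4 * k * (e \<bullet> v)\<^sup>2"
    if "e \<bullet> v \<noteq> 0" "(norm v)\<^sup>2 \<le> (1 + q) * (e \<bullet> v)\<^sup>2" for v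
  proof -
    have "q * (e \<bullet> v)\<^sup>2 < 4 * k * (e \<bullet> v)\<^sup>2"
      using that(1) k(3) by (intro mult_strict_right_mono) auto
    with that(2) show ?thesis by (simp add: distrib_right)
  qed
  have C1: "0 < e \<bullet> (x - a)" "(norm (x - a))\<^sup>2 \<le> (1 + q) * (e \<bullet> (x - a))\<^sup>2" if "x \<in> C\<^sub>1" for x
  proof -
    have eq: "u + (x - c\<^sub>1) = x - a"
      by (simp add: u_def a_def vec_eq_iff field_simps)
    have "n \<bullet> (x - c\<^sub>1) = 0"
      using that assms(10) c1 by (auto simp: P inner_diff_right)
    from cone[OF this c1(2)[OF that]]
    show "0 < e \<bullet> (x - a)" "(norm (x - a))\<^sup>2 \<le> (1 + q) * (e \<bullet> (x - a))\<^sup>2"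
      unfolding eq by simp_all
  qed
  have C2: "e \<bullet> (x - a) < 0" "(norm (x - a))\<^sup>2 \<le> (1 + q) * (e \<bullet> (x - a))\<^sup>2" if "x \<in> C\<^sub>2" for x
  proof -
    \<comment> \<open>Reflection in \<open>a\<close> carries the second disc to the height of the
      first, so the same cone estimate applies with the sign of \<open>e \<bullet> (x - a)\<close>
      reversed.\<close>
    have eq: "u + (c\<^sub>2 - x) = - (x - a)"
      by (simp add: u_def a_def vec_eq_iff field_simps)
    have "n \<bullet> (c\<^sub>2 - x) = 0"
      using that assms(11) c2 by (auto simp: P inner_diff_right)
    moreover have "(norm (c\<^sub>2 - x))\<^sup>2 \<le> d\<^sup>2 / 2"
      using c2(2)[OF that] by (simp add: norm_minus_commute)
    ultimately have "0 < e \<bullet> - (x - a) \<and> (norm (- (x - a)))\<^sup>2 \<le> (1 + q) * (e \<bullet> - (x - a))\<^sup>2"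
      using cone unfolding eq[symmetric] by blast
    then show "e \<bullet> (x - a) < 0" "(norm (x - a))\<^sup>2 \<le> (1 + q) * (e \<bullet> (x - a))\<^sup>2"
      unfolding inner_minus_right norm_minus_cancel power2_minus neg_0_less_iff_less by (rule conjunct1, rule conjunct2)
  qed
  have boundary: "(norm (F p - a))\<^sup>2 - (e \<bullet> (F p - a))\<^sup>2 < 4 * k * (e \<bullet> (F p - a))\<^sup>2"
    if "p \<in> surface_boundary S" for p
  proof (rule strict)
    have "F p \<in> C\<^sub>1 \<union> C\<^sub>2" using that assms(16) by blast
    then show "e \<bullet> (F p - a) \<noteq> 0" "(norm (F p - a))\<^sup>2 \<le> (1 + q) * (e \<bullet> (F p - a))\<^sup>2"
      using C1[of "F p"] C2[of "F p"] by auto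
  qed
  \<comment> \<open>A point on each curve gives boundary points on both sides of the plane through
    \<open>a\<close> orthogonal to \<open>e\<close>.\<close>
  obtain x\<^sub>1 x\<^sub>2 where "x\<^sub>1 \<in> C\<^sub>1" "x\<^sub>2 \<in> C\<^sub>2"
    using C(1,3) by blast
  moreover from this have "x\<^sub>1 \<in> F ` surface_boundary S" "x\<^sub>2 \<in> F ` surface_boundary S"
    unfolding assms(16) by simp_all
  ultimately obtain p\<^sub>1 p\<^sub>2 where "p\<^sub>1 \<in> surface_boundary S" "F p\<^sub>1 \<in> C\<^sub>1" "p\<^sub>2 \<in> surface_boundary S" "F p\<^sub>2 \<in> C\<^sub>2"
    by blast
  then show False
    using no_connected_minimal_surface_in_cone[OF assms(13-15) e k(1,2) boundary, of p\<^sub>1 p\<^sub>2]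
      C1(1)[of "F p\<^sub>1"] C2(1)[of "F p\<^sub>2"] by (auto simp: surface_boundary_def)
qed

end
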